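(* Let $\mathcal{H}$ be a hereditary property of simple ordered graphs and let $\varepsilon>0$. There exist a positive integer $M=M_{\mathcal{H}}(\varepsilon)$ and a consecutive stochastic block model with $m\le M$ blocks with equal containment probabilities (i.e. $q_i=1/m$ for every $i\in[m]$) such that a graph $G$ on $n$ vertices generated by this model satisfies $$d_1(G,\mathcal{H})\ge\overline{d_{\mathcal{H}}}-\varepsilon$$ with probability that tends to one as $n\to\infty$.
   Context: A simple ordered graph on $n$ vertices is a loopless graph on $[n]$ with its natural order; two ordered graphs are isomorphic only if they are equal. A property of ordered graphs is hereditary if it is closed under taking induced (ordered) subgraphs. For ordered graphs $G,G'$ on $n$ vertices, $d_1(G,G')$ is the number of entries in which the $n\times n$ adjacency matrices differ, divided by $n^2$. $d_1(G,\mathcal{H})=\min_{G'}d_1(G,G')$ over all $G'\in\mathcal{H}$ with the same number of vertices as $G$ (interpreted as $+\infty$ if there is none), and $\overline{d_{\mathcal{H}}}=\sup_G d_1(G,\mathcal{H})$, where $G$ ranges over all simple ordered graphs of any size. A stochastic block model with $m$ blocks has parameters: the number $n$ of vertices, a probability vector $(q_1,\dots,q_m)$, and a symmetric $m\times m$ matrix $(p_{ij})$ of probabilities. To generate a graph: assign each of the $n$ vertices independently to one of the parts $A_1,\dots,A_m$, to $A_i$ with probability $q_i$; then for any pair of distinct vertices $u\in A_i$, $v\in A_j$, add the edge $uv$ with probability $p_{ij}$, independently over pairs. The model is consecutive if all vertices assigned to $A_i$ precede, in the vertex ordering, all vertices assigned to $A_{i+1}$, for every $i\in[m-1]$ (i.e.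 the vertices are ordered so that the parts are consecutive intervals). The parameters $m,(q_i),(p_{ij})$ do not depend on $n$. *)

theory Defs
  imports "HOL-Probability.Probability"
begin

text \<open>An ordered graph is a pair of its number of vertices \<open>n\<close> and its adjacency relation. The
  vertex set is \<open>{..<n}\<close> (so vertices and blocks are numbered from \<open>0\<close>) with the order of
  \<^typ>\<open>nat\<close>; equality of pairs is then equality, hence isomorphism, of ordered graphs.\<close>

type_synonym ograph = "nat \<times> (nat \<times> nat) set"

abbreviation nverts :: "ograph \<Rightarrow> nat" where "nverts \<equiv> fst"
abbreviation adj :: "ograph \<Rightarrow> (nat \<times> nat) set" where "adj \<equiv> snd"

definition simple_ograph :: "ograph \<Rightarrow> bool" where
  "simple_ograph G \<longleftrightarrow>
     adj G \<subseteq> {..<nverts G} \<times> {..<nverts G} \<and> sym (adj G) \<and> irrefl (adj G)"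

text \<open>The \<open>i\<close>-th vertex of the induced subgraph is the \<open>i\<close>-th smallest element of \<open>S\<close>.\<close>

definition induced_subgraph :: "ograph \<Rightarrow> nat set \<Rightarrow> ograph" where
  "induced_subgraph G S =
     (card S, {(i, j). i < card S \<and> j < card S \<and>
                 (sorted_list_of_set S ! i, sorted_list_of_set S ! j) \<in> adj G})"

definition hereditary :: "ograph set \<Rightarrow> bool" where
  "hereditary \<H> \<longleftrightarrow>
     (\<forall>G\<in>\<H>. simple_ograph G \<and> (\<forall>S. S \<subseteq> {..<nverts G} \<longrightarrow> induced_subgraph G S \<in> \<H>))"

text \<open>Only used for graphs with the same number of vertices. Each differing edge is counted
  twice, once for each of the two matrix entries.\<close>

definition d1 :: "ograph \<Rightarrow> ograph \<Rightarrow> real" where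
  "d1 G G' =
     real (card {(i, j). i < nverts G \<and> j < nverts G \<and> ((i, j) \<in> adj G) \<noteq> ((i, j) \<in> adj G')})
       / (real (nverts G))\<^sup>2"

text \<open>The infimum is over a finite set, hence a minimum, and is \<open>\<infinity>\<close> if that set is empty.\<close>

definition d1_prop :: "ograph \<Rightarrow> ograph set \<Rightarrow> ereal" where
  "d1_prop G \<H> = (INF G'\<in>{G'\<in>\<H>. nverts G' = nverts G}. ereal (d1 G G'))"

definition max_d1 :: "ograph set \<Rightarrow> ereal" where
  "max_d1 \<H> = (SUP G\<in>{G. simple_ograph G}. d1_prop G \<H>)"

text \<open>The probability vector is a PMF \<open>q\<close> on the block indices \<open>{..<m}\<close>; since its support is
  nonempty, this forces \<open>m > 0\<close>.\<close>

definition sbm_params :: "nat \<Rightarrow> nat pmf \<Rightarrow> (nat \<Rightarrow> nat \<Rightarrow> real) \<Rightarrow> bool" where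
  "sbm_params m q p \<longleftrightarrow>
     set_pmf q \<subseteq> {..<m} \<and> (\<forall>i<m. \<forall>j<m. 0 \<le> p i j \<and> p i j \<le> 1 \<and> p i j = p j i)"

text \<open>Given the list \<open>c\<close> of the blocks of the vertices, one independent coin is flipped for each
  pair \<open>i < j\<close>; outside these pairs the coin function \<open>x\<close> is constantly \<^const>\<open>False\<close>.\<close>

definition block_graph_pmf :: "(nat \<Rightarrow> nat \<Rightarrow> real) \<Rightarrow> nat list \<Rightarrow> ograph pmf" where
  "block_graph_pmf p c =
     map_pmf (\<lambda>x. (length c, {(i, j). x (i, j) \<or> x (j, i)}))
       (Pi_pmf {(i, j). i < j \<and> j < length c} False (\<lambda>(i, j). bernoulli_pmf (p (c ! i) (c ! j))))"

text \<open>The \<open>n\<close> vertices are independently assigned to blocks, then the vertices are ordered by block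
  (sorting the list of blocks), so that the blocks are consecutive intervals. The order within a
  block is irrelevant, as the edge probabilities depend only on the blocks.\<close>

definition consecutive_sbm :: "nat pmf \<Rightarrow> (nat \<Rightarrow> nat \<Rightarrow> real) \<Rightarrow> nat \<Rightarrow> ograph pmf" where
  "consecutive_sbm q p n = bind_pmf (map_pmf sort (replicate_pmf n q)) (block_graph_pmf p)"

end

theory Submission
  imports Defs "HOL-Real_Asymp.Real_Asymp"
begin

text \<open>
  Take a graph \<open>G\<close> on \<open>N\<close> vertices whose distance \<open>d\<close> from \<open>\<H>\<close> nearly attains the supremum, and
  blow it up: use \<open>N\<close> equally likely blocks and let the edge probability between blocks \<open>i\<close> and
  \<open>j\<close> be \<open>1\<close> or \<open>0\<close> according to whether \<open>ij\<close> is an edge of \<open>G\<close>. All randomness is then in the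
  block sizes.

  A blow-up with blocks of nearly equal size is about as far from \<open>\<H>\<close> as \<open>G\<close> itself. Since the blocks are consecutive intervals,
  a choice of one vertex from each block (a transversal) induces a copy of \<open>G\<close> in the blow-up,
  and, in a graph \<open>G' \<in> \<H>\<close> on the same vertices, an ordered graph that is again in \<open>\<H>\<close> because
  \<open>\<H>\<close> is hereditary. So \<open>G'\<close> differs from the blow-up in at least \<open>N\<^sup>2 d\<close> entries on each
  transversal. With \<open>s\<close> vertices taken from every block there are \<open>s ^ N\<close> transversals, and an
  entry lies on at most \<open>s ^ (N - 2)\<close> of them; so in total there are at least \<open>s\<^sup>2 N\<^sup>2 d\<close>
  differing entries. Differences inside a block can only increase this number. The double count is
  \<open>mismatches_of_transversals\<close>, and its consequence for \<open>\<H>\<close> is \<open>card_mismatches_blow_up_ge\<close>.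

  By Hoeffding's inequality all blocks have at least \<open>\<theta> n / N\<close> vertices with probability tending
  to one, for every fixed \<open>\<theta> < 1\<close> (\<open>blocks_large_tendsto_1\<close>). The distance is then at least
  \<open>\<theta>\<^sup>2 d\<close>, and \<open>\<theta>\<close> close to \<open>1\<close> gives the theorem. The remaining cases are degenerate: if the
  bound to be proved is not positive, every model works; if the supremum is infinite, then \<open>\<H>\<close> has
  no graphs of some size, hence none of any larger size, and again every model works.
\<close>

section \<open>Transversals\<close>

definition mismatches :: "ograph \<Rightarrow> ograph \<Rightarrow> (nat \<times> nat) set" where
  "mismatches G G' = {(i, j). i < nverts G \<and> j < nverts G \<and> ((i, j) \<in> adj G) \<noteq> ((i, j) \<in> adj G')}"

text \<open>For strictly increasing \<open>f\<close> this is the induced subgraph on the range of \<open>f\<close>, in a form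
  that keeps track of which vertex \<open>f i\<close> represents block \<open>i\<close>.\<close>

definition pullback :: "nat \<Rightarrow> (nat \<Rightarrow> nat) \<Rightarrow> ograph \<Rightarrow> ograph" where
  "pullback N f G = (N, {(i, j). i < N \<and> j < N \<and> (f i, f j) \<in> adj G})"

lemma d1_eq_card_mismatches: "d1 G G' = real (card (mismatches G G')) / (real (nverts G))\<^sup>2"
  by (simp add: d1_def mismatches_def)

lemma finite_mismatches [simp]: "finite (mismatches G G')"
  by (rule finite_subset[of _ "{..<nverts G} \<times> {..<nverts G}"]) (auto simp: mismatches_def)

lemma induced_subgraph_image:
  assumes f: "strict_mono_on {..<N} f"
  shows "induced_subgraph G (f ` {..<N}) = pullback N f G"
proof -
  have inj: "inj_on f {..<N}"
    using f by (rule strict_mono_on_imp_inj_on)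
  have "sorted (map f [0..<N])"
    using f by (auto simp: sorted_iff_nth_mono strict_mono_on_def le_less)
  moreover have "distinct (map f [0..<N])"
    using inj by (simp add: distinct_map atLeast0LessThan)
  ultimately have "sorted_list_of_set (set (map f [0..<N])) = map f [0..<N]"
    by (simp only: sorted_list_of_set.idem_if_sorted_distinct)
  hence "sorted_list_of_set (f ` {..<N}) = map f [0..<N]"
    by (simp add: atLeast0LessThan)
  moreover have "card (f ` {..<N}) = N"
    using inj by (simp add: card_image)
  ultimately show ?thesis
    by (auto simp: induced_subgraph_def pullback_def)
qed

lemma card_PiE_two_fixed_le:
  assumes I: "finite I" "i \<in> I" "j \<in> I" "i \<noteq> j"
    and A: "\<And>k. k \<in> I \<Longrightarrow> finite (A k)" "\<And>k. k \<in> I \<Longrightarrow> card (A k) = s"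
  shows "card {f \<in> PiE I A. f i = u \<and> f j = v} \<le> s ^ (card I - 2)"
proof -
  let ?A = "A(i := {u}, j := {v})"
  have fin: "finite (PiE I ?A)"
    using I A by (intro finite_PiE) auto
  have "{f \<in> PiE I A. f i = u \<and> f j = v} \<subseteq> PiE I ?A"
    by (auto simp: PiE_iff extensional_def)
  hence "card {f \<in> PiE I A. f i = u \<and> f j = v} \<le> card (PiE I ?A)"
    by (rule card_mono[OF fin])
  also have "\<dots> = (\<Prod>k\<in>I. card (?A k))"
    using I by (simp add: card_PiE)
  also have "\<dots> = (\<Prod>k\<in>I - {i, j}. card (?A k))"
    using I by (intro prod.mono_neutral_right) auto
  also have "\<dots> = (\<Prod>k\<in>I - {i, j}. s)"
    using A by (intro prod.cong) auto
  also have "\<dots> = s ^ (card I - 2)"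
    using I by (simp add: card_Diff_subset numeral_2_eq_2)
  finally show ?thesis .
qed

text \<open>
  Double counting of the pairs of a transversal \<open>f\<close> and a mismatched entry \<open>w\<close> that \<open>f\<close> hits. For
  fixed \<open>f\<close> there are at least \<open>K\<close> such entries. For fixed \<open>w\<close> there are at most \<open>s ^ (N - 2)\<close>
  such transversals: the classes \<open>B i\<close> are disjoint, so the endpoints of \<open>w\<close> determine the two
  classes in which \<open>f\<close> is prescribed.
\<close>

lemma mismatches_of_transversals:
  fixes K :: real
  assumes B: "\<And>i. i < N \<Longrightarrow> B i \<subseteq> {..<nverts H}" "\<And>i. i < N \<Longrightarrow> card (B i) = s"
    and disj: "\<And>i j v. i < N \<Longrightarrow> j < N \<Longrightarrow> v \<in> B i \<Longrightarrow> v \<in> B j \<Longrightarrow> i = j"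
    and H: "\<And>i j u v. i < N \<Longrightarrow> j < N \<Longrightarrow> i \<noteq> j \<Longrightarrow> u \<in> B i \<Longrightarrow> v \<in> B j \<Longrightarrow>
              (u, v) \<in> adj H \<longleftrightarrow> (i, j) \<in> adj G"
    and G: "nverts G = N" "irrefl (adj G)" and G': "irrefl (adj G')"
    and K: "\<And>f. f \<in> PiE {..<N} B \<Longrightarrow> K \<le> real (card (mismatches G (pullback N f G')))"
  shows "real s ^ 2 * K \<le> real (card (mismatches H G'))"
proof (cases "s = 0 \<or> K \<le> 0")
  case True
  thus ?thesis
    by (auto intro: order_trans[OF mult_nonneg_nonpos])
next
  case False
  hence s: "s > 0" and K0: "K > 0"
    by auto
  define T where "T = PiE {..<N} B"
  define M where "M = mismatches H G'"
  define hit where "hit f w \<longleftrightarrow> (\<exists>i<N. \<exists>j<N. i \<noteq> j \<and> f i = fst w \<and> f j = snd w)"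
    for f :: "nat \<Rightarrow> nat" and w :: "nat \<times> nat"
  have finB: "finite (B i)" if "i < N" for i
    using B(1)[OF that] by (rule finite_subset) simp
  have finT: "finite T"
    unfolding T_def using finB by (intro finite_PiE) auto
  have cardT: "card T = s ^ N"
    unfolding T_def using B(2) by (simp add: card_PiE)
  have finM: "finite M"
    by (simp add: M_def)

  have per_transversal: "K \<le> real (card {w \<in> M. hit f w})" if f: "f \<in> T" for f
  proof -
    let ?D = "mismatches G (pullback N f G')"
    have fB: "f i \<in> B i" if "i < N" for i
      using f that by (auto simp: T_def)
    have "inj_on (\<lambda>(i, j). (f i, f j)) ?D"
      using fB disj G(1) by (auto simp: inj_on_def mismatches_def) (metis+)
    moreover have "(\<lambda>(i, j). (f i, f j)) ` ?D \<subseteq> {w \<in> M. hit f w}"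
    proof clarify
      fix i j assume ij: "(i, j) \<in> ?D"
      have lt: "i < N" "j < N" and diff: "((i, j) \<in> adj G) \<noteq> ((f i, f j) \<in> adj G')"
        using ij G(1) by (auto simp: mismatches_def pullback_def)
      have ne: "i \<noteq> j"
        using diff G(2) G' by (auto simp: irrefl_def)
      have "f i < nverts H" "f j < nverts H"
        using fB B(1) lt by blast+
      moreover have "(f i, f j) \<in> adj H \<longleftrightarrow> (i, j) \<in> adj G"
        using H[OF lt ne] fB lt by blast
      ultimately show "(f i, f j) \<in> M \<and> hit f (f i, f j)"
        using lt ne diff by (auto simp: M_def mismatches_def hit_def)
    qed
    ultimately have "card ?D \<le> card {w \<in> M. hit f w}"
      using finM by (intro card_inj_on_le) auto
    thus ?thesis
      using K[of f] f by (simp add: T_def)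
  qed

  have per_mismatch: "card {f \<in> T. hit f w} \<le> s ^ (N - 2)" if "w \<in> M" for w
  proof (cases "\<exists>f\<in>T. hit f w")
    case False
    hence "{f \<in> T. hit f w} = {}"
      by blast
    thus ?thesis
      by (simp only: card.empty zero_le)
  next
    case True
    then obtain g i j where g: "g \<in> T" "i < N" "j < N" "i \<noteq> j" "g i = fst w" "g j = snd w"
      by (auto simp: hit_def)
    have w: "fst w \<in> B i" "snd w \<in> B j"
      using PiE_mem[of g "{..<N}" B] g by (auto simp: T_def simp flip: g(5,6))
    have "{f \<in> T. hit f w} \<subseteq> {f \<in> PiE {..<N} B. f i = fst w \<and> f j = snd w}"
    proof clarify
      fix f assume f: "f \<in> T" "hit f w"
      then obtain i' j' where f': "i' < N" "j' < N" "f i' = fst w" "f j' = snd w"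
        by (auto simp: hit_def)
      moreover have "f i' \<in> B i'" "f j' \<in> B j'"
        using PiE_mem[of f "{..<N}" B] f(1) f'(1,2) by (simp_all add: T_def del: PiE_iff)
      ultimately have "i' = i" "j' = j"
        using disj g w by metis+
      thus "f \<in> PiE {..<N} B \<and> f i = fst w \<and> f j = snd w"
        using f f' by (auto simp: T_def)
    qed
    hence "card {f \<in> T. hit f w} \<le> card {f \<in> PiE {..<N} B. f i = fst w \<and> f j = snd w}"
      using finT by (intro card_mono) (auto simp: T_def)
    also have "\<dots> \<le> s ^ (N - 2)"
      using card_PiE_two_fixed_le[of "{..<N}" i j B s "fst w" "snd w"] g finB B(2) by simp
    finally show ?thesis .
  qed

  have "real s ^ N * K = (\<Sum>f\<in>T. K)"
    by (simp add: cardT)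
  also have "\<dots> \<le> (\<Sum>f\<in>T. real (card {w \<in> M. hit f w}))"
    by (intro sum_mono per_transversal)
  also have "\<dots> = (\<Sum>f\<in>T. \<Sum>w\<in>M. of_bool (hit f w))"
    using finM by (simp add: Collect_conj_eq Int_commute)
  also have "\<dots> = (\<Sum>w\<in>M. \<Sum>f\<in>T. of_bool (hit f w))"
    by (rule sum.swap)
  also have "\<dots> = (\<Sum>w\<in>M. real (card {f \<in> T. hit f w}))"
    using finT by (simp add: Collect_conj_eq Int_commute)
  also have "\<dots> \<le> (\<Sum>w\<in>M. real s ^ (N - 2))"
    using per_mismatch by (intro sum_mono) (metis of_nat_le_iff of_nat_power)
  finally have main: "real s ^ N * K \<le> real (card M) * real s ^ (N - 2)"
    by simp
  \<comment> \<open>Excludes truncation of the exponent \<open>N - 2\<close>: for \<open>N < 2\<close> a transversal hits no entry off the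
    diagonal, contradicting \<open>K > 0\<close>.\<close>
  have "N \<ge> 2"
  proof (rule ccontr)
    assume "\<not> N \<ge> 2"
    hence none: "\<not> hit f w" for f w
      by (auto simp: hit_def)
    obtain f where "f \<in> T"
      using cardT s by (metis card.empty ex_in_conv power_eq_0_iff less_irrefl)
    from per_transversal[OF this] none K0 show False
      by simp
  qed
  hence "real s ^ N = real s ^ (N - 2) * real s ^ 2"
    by (metis le_add_diff_inverse2 power_add)
  with main have "real s ^ (N - 2) * (real s ^ 2 * K) \<le> real s ^ (N - 2) * real (card M)"
    by (simp add: mult_ac)
  thus ?thesis
    using s by (simp add: M_def)
qed

section \<open>Blow-ups\<close>

definition blow_up :: "ograph \<Rightarrow> nat list \<Rightarrow> ograph" where
  "blow_up G c = (length c, {(u, v). u < length c \<and> v < length c \<and> (c ! u, c ! v) \<in> adj G})"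

lemma card_block: "card {v. v < length c \<and> c ! v = i} = count_list c i"
  by (simp add: count_list_eq_length_filter length_filter_conv_card eq_commute)

text \<open>
  The double count with \<open>B i\<close> an arbitrary set of exactly \<open>s\<close> vertices of block \<open>i\<close>. Sortedness of
  \<open>c\<close> makes every transversal strictly increasing, so that what it induces in \<open>G'\<close> is an induced
  ordered subgraph, with the vertex from block \<open>i\<close> in position \<open>i\<close>.
\<close>

lemma card_mismatches_blow_up_ge:
  assumes \<H>: "hereditary \<H>" and G: "simple_ograph G" "ereal d \<le> d1_prop G \<H>"
    and c: "sorted c" "\<And>i. i < nverts G \<Longrightarrow> s \<le> count_list c i"
    and G': "G' \<in> \<H>" "nverts G' = length c"
  shows "real s ^ 2 * (real (nverts G) ^ 2 * d) \<le> real (card (mismatches (blow_up G c) G'))"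
proof -
  define N where "N = nverts G"
  have "\<exists>B. \<forall>i<N. B i \<subseteq> {v. v < length c \<and> c ! v = i} \<and> card (B i) = s"
    using c(2) by (intro choice allI) (metis N_def card_block obtain_subset_with_card_n)
  then obtain B where B: "\<And>i. i < N \<Longrightarrow> B i \<subseteq> {v. v < length c \<and> c ! v = i}"
    "\<And>i. i < N \<Longrightarrow> card (B i) = s"
    by blast
  have B_iff: "v < length c \<and> c ! v = i" if "v \<in> B i" "i < N" for v i
    using that B(1) by blast
  have simple: "irrefl (adj G)" "irrefl (adj G')"
    using G(1) \<H> G'(1) by (auto simp: simple_ograph_def hereditary_def)
  show ?thesis
    unfolding N_def[symmetric]
  proof (rule mismatches_of_transversals[where B = B and N = N and G = G])
    fix f assume f: "f \<in> PiE {..<N} B"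
    hence f_block: "f i < length c" "c ! f i = i" if "i < N" for i
      using that B_iff by (auto simp: PiE_iff)
    have "strict_mono_on {..<N} f"
    proof (rule strict_mono_onI)
      fix i j assume ij: "i \<in> {..<N}" "j \<in> {..<N}" "i < j"
      show "f i < f j"
      proof (rule ccontr)
        assume "\<not> f i < f j"
        hence "c ! f j \<le> c ! f i"
          using c(1) ij f_block by (intro sorted_nth_mono) auto
        thus False
          using ij f_block by simp
      qed
    qed
    hence eq: "induced_subgraph G' (f ` {..<N}) = pullback N f G'"
      by (rule induced_subgraph_image)
    have "f ` {..<N} \<subseteq> {..<nverts G'}"
      using f_block G'(2) by auto
    hence "pullback N f G' \<in> \<H>"
      using \<H> G'(1) eq unfolding hereditary_def by metis
    hence "d1_prop G \<H> \<le> ereal (d1 G (pullback N f G'))"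
      unfolding d1_prop_def by (intro INF_lower) (auto simp: pullback_def N_def)
    hence "d \<le> d1 G (pullback N f G')"
      using G(2) order_trans ereal_less_eq(3) by blast
    \<comment> \<open>For \<open>N = 0\<close> the quotient in \<^const>\<open>d1\<close> is \<open>0 / 0\<close>, but then the left-hand side vanishes.\<close>
    thus "real N ^ 2 * d \<le> real (card (mismatches G (pullback N f G')))"
      by (cases "N = 0") (simp_all add: d1_eq_card_mismatches N_def pos_le_divide_eq mult_ac)
  next
    fix i j u v assume "i < N" "j < N" "i \<noteq> j" "u \<in> B i" "v \<in> B j"
    thus "(u, v) \<in> adj (blow_up G c) \<longleftrightarrow> (i, j) \<in> adj G"
      using B_iff[of u i] B_iff[of v j] by (simp add: blow_up_def)
  next
    show "i = j" if "i < N" "j < N" "v \<in> B i" "v \<in> B j" for i j v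
      using B_iff that by metis
  qed (use B simple in \<open>auto simp: N_def blow_up_def\<close>)
qed

lemma d1_prop_blow_up_ge:
  assumes \<H>: "hereditary \<H>" and G: "simple_ograph G" "ereal d \<le> d1_prop G \<H>" "nverts G > 0"
    and d: "d \<ge> 0" and \<theta>: "\<theta> \<ge> 0" and c: "sorted c" "c \<noteq> []"
    and count: "\<And>i. i < nverts G \<Longrightarrow> \<theta> * (real (length c) / real (nverts G)) \<le> real (count_list c i)"
  shows "ereal (\<theta>\<^sup>2 * d) \<le> d1_prop (blow_up G c) \<H>"
  unfolding d1_prop_def
proof (rule INF_greatest)
  fix G' assume "G' \<in> {G' \<in> \<H>. nverts G' = nverts (blow_up G c)}"
  hence G': "G' \<in> \<H>" "nverts G' = length c"
    by (auto simp: blow_up_def)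
  define t where "t = \<theta> * (real (length c) / real (nverts G))"
  define s where "s = nat \<lceil>t\<rceil>"
  have t: "0 \<le> t" "t \<le> real s"
    using \<theta> by (auto simp: t_def s_def real_nat_ceiling_ge)
  have "s \<le> count_list c i" if "i < nverts G" for i
    using count[OF that] by (simp add: s_def t_def ceiling_le_iff nat_le_iff)
  hence "real s ^ 2 * (real (nverts G) ^ 2 * d) \<le> real (card (mismatches (blow_up G c) G'))"
    by (intro card_mismatches_blow_up_ge[OF \<H> G(1,2) c(1) _ G']) auto
  moreover have "t ^ 2 * (real (nverts G) ^ 2 * d) \<le> real s ^ 2 * (real (nverts G) ^ 2 * d)"
    using t d by (intro mult_right_mono power_mono) auto
  moreover have "t ^ 2 * (real (nverts G) ^ 2 * d) = \<theta>\<^sup>2 * d * (real (length c))\<^sup>2"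
    using G(3) by (simp add: t_def power_mult_distrib power_divide)
  ultimately have "\<theta>\<^sup>2 * d * (real (length c))\<^sup>2 \<le> real (card (mismatches (blow_up G c) G'))"
    by linarith
  thus "ereal (\<theta>\<^sup>2 * d) \<le> ereal (d1 (blow_up G c) G')"
    using c(2) by (simp add: d1_eq_card_mismatches blow_up_def pos_le_divide_eq)
qed

text \<open>With edge probabilities \<open>0\<close> and \<open>1\<close> every coin is deterministic. Since \<open>G\<close> is irreflexive,
  pairs inside a block get probability \<open>0\<close>.\<close>

lemma block_graph_pmf_0_1:
  assumes G: "simple_ograph G" and c: "set c \<subseteq> {..<nverts G}"
  shows "block_graph_pmf (\<lambda>i j. of_bool ((i, j) \<in> adj G)) c = return_pmf (blow_up G c)"
proof -
  let ?E = "{(i, j). i < j \<and> j < length c}"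
  have fin: "finite ?E"
    by (rule finite_subset[of _ "{..<length c} \<times> {..<length c}"]) auto
  have bern: "bernoulli_pmf (of_bool b) = return_pmf b" for b
    by (cases b) (auto intro!: pmf_eqI simp: indicator_def)
  have "(\<lambda>(i, j). bernoulli_pmf (of_bool ((c ! i, c ! j) \<in> adj G))) =
          (\<lambda>e. return_pmf ((c ! fst e, c ! snd e) \<in> adj G))"
    by (simp add: bern fun_eq_iff)
  hence "block_graph_pmf (\<lambda>i j. of_bool ((i, j) \<in> adj G)) c =
     return_pmf (length c, {(i, j). (i < j \<and> j < length c \<and> (c ! i, c ! j) \<in> adj G) \<or>
                                    (j < i \<and> i < length c \<and> (c ! j, c ! i) \<in> adj G)})"
    using fin by (auto simp: block_graph_pmf_def)
  also have "{(i, j). (i < j \<and> j < length c \<and> (c ! i, c ! j) \<in> adj G) \<or>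
                      (j < i \<and> i < length c \<and> (c ! j, c ! i) \<in> adj G)} = adj (blow_up G c)"
  proof -
    have "sym (adj G)" "irrefl (adj G)"
      using G by (auto simp: simple_ograph_def)
    thus ?thesis
      by (auto simp: blow_up_def sym_def irrefl_def) (metis nat_neq_iff)
  qed
  finally show ?thesis
    by (simp add: blow_up_def)
qed

lemma consecutive_sbm_0_1:
  assumes G: "simple_ograph G" and q: "set_pmf q \<subseteq> {..<nverts G}"
  shows "consecutive_sbm q (\<lambda>i j. of_bool ((i, j) \<in> adj G)) n =
           map_pmf (\<lambda>c. blow_up G (sort c)) (replicate_pmf n q)"
  unfolding consecutive_sbm_def bind_map_pmf map_pmf_def[of "\<lambda>c. blow_up G (sort c)"]
  using q by (intro bind_pmf_cong refl block_graph_pmf_0_1[OF G]) (auto simp: set_replicate_pmf)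

section \<open>Block sizes\<close>

lemma count_list_replicate_pmf:
  "map_pmf (\<lambda>c. count_list c i) (replicate_pmf n q) = binomial_pmf n (pmf q i)"
proof (induction n)
  case 0
  show ?case
    by (simp add: binomial_pmf_0 pmf_le_1)
next
  case (Suc n)
  have eq: "map_pmf (\<lambda>x. x = i) q = bernoulli_pmf (pmf q i)"
  proof -
    have "pmf (map_pmf (\<lambda>x. x = i) q) True = pmf q i"
      by (simp add: pmf_map vimage_def pmf.rep_eq)
    thus ?thesis
      by (intro pmf_eqI) (metis (full_types) pmf_False_conv_True pmf_bernoulli_True pmf_le_1 pmf_nonneg)
  qed
  have "map_pmf (\<lambda>c. count_list c i) (replicate_pmf (Suc n) q) =
          do {b \<leftarrow> map_pmf (\<lambda>x. x = i) q; k \<leftarrow> map_pmf (\<lambda>c. count_list c i) (replicate_pmf n q);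
              return_pmf ((if b then 1 else 0) + k)}"
    by (simp add: map_bind_pmf bind_map_pmf map_pmf_def bind_assoc_pmf bind_return_pmf)
       (intro bind_pmf_cong refl, auto)
  also have "\<dots> = binomial_pmf (Suc n) (pmf q i)"
    unfolding eq Suc.IH by (simp add: binomial_pmf_Suc pmf_le_1)
  finally show ?case .
qed

lemma blocks_large_tendsto_1:
  assumes m: "m > 0" and \<theta>: "\<theta> < 1"
  shows "(\<lambda>n. measure_pmf.prob (replicate_pmf n (pmf_of_set {..<m}))
            {c. \<forall>i<m. \<theta> * (real n / real m) \<le> real (count_list c i)}) \<longlonglongrightarrow> 1"
proof -
  let ?P = "\<lambda>n. replicate_pmf n (pmf_of_set {..<m})"
  define \<delta> where "\<delta> = (1 - \<theta>) / real m"
  have \<delta>: "\<delta> > 0"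
    using m \<theta> by (simp add: \<delta>_def)
  have tail: "measure_pmf.prob (?P n) {c. real (count_list c i) < \<theta> * (real n / real m)}
                \<le> exp (- 2 * real n * \<delta>\<^sup>2)" if "i < m" "n > 0" for i n
  proof -
    have pmf_block: "pmf (pmf_of_set {..<m}) i = 1 / real m"
      using that m by (subst pmf_of_set) (auto simp: lessThan_empty_iff)
    interpret binomial_distribution n "1 / real m"
      by unfold_locales (use m in auto)
    have "measure_pmf.prob (?P n) {c. real (count_list c i) < \<theta> * (real n / real m)} =
            measure_pmf.prob (map_pmf (\<lambda>c. count_list c i) (?P n))
              {x. real x < \<theta> * (real n / real m)}"
      by (simp add: vimage_def)
    also have "\<dots> = measure_pmf.prob (binomial_pmf n (1 / real m)) {x. real x < \<theta> * (real n / real m)}"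
      by (simp only: count_list_replicate_pmf pmf_block)
    also have "\<dots> \<le> measure_pmf.prob (binomial_pmf n (1 / real m)) {x. real x / real n \<le> 1 / real m - \<delta>}"
      using that m by (intro measure_pmf.finite_measure_mono) (auto simp: \<delta>_def field_simps)
    also have "\<dots> \<le> exp (- 2 * real n * \<delta>\<^sup>2)"
      using prob_le'[of \<delta>] \<delta> that by simp
    finally show ?thesis .
  qed
  have lower: "1 - real m * exp (- 2 * real n * \<delta>\<^sup>2) \<le>
      measure_pmf.prob (?P n) {c. \<forall>i<m. \<theta> * (real n / real m) \<le> real (count_list c i)}"
    if "n > 0" for n
  proof -
    let ?A = "\<lambda>i. {c. real (count_list c i) < \<theta> * (real n / real m)}"
    have "measure_pmf.prob (?P n) (\<Union>i<m. ?A i) \<le> (\<Sum>i<m. measure_pmf.prob (?P n) (?A i))"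
      by (intro measure_pmf.finite_measure_subadditive_finite) auto
    also have "\<dots> \<le> (\<Sum>i<m. exp (- 2 * real n * \<delta>\<^sup>2))"
      using tail that by (intro sum_mono) auto
    finally have "measure_pmf.prob (?P n) (\<Union>i<m. ?A i) \<le> real m * exp (- 2 * real n * \<delta>\<^sup>2)"
      by simp
    moreover have "{c. \<forall>i<m. \<theta> * (real n / real m) \<le> real (count_list c i)} = UNIV - (\<Union>i<m. ?A i)"
      by (auto simp: not_less)
    ultimately show ?thesis
      using measure_pmf.prob_compl[of "\<Union>i<m. ?A i" "?P n"] by simp
  qed
  have "(\<lambda>n. 1 - real m * exp (- 2 * real n * \<delta>\<^sup>2)) \<longlonglongrightarrow> 1"
    using \<delta> by real_asymp
  thus ?thesis
    by (rule tendsto_sandwich[rotated 2, OF _ tendsto_const])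
       (use lower in \<open>auto intro: eventually_mono[OF eventually_gt_at_top[of 0]]\<close>)
qed

section \<open>The block model\<close>

lemma nverts_consecutive_sbm: "G \<in> set_pmf (consecutive_sbm q p n) \<Longrightarrow> nverts G = n"
  by (auto simp: consecutive_sbm_def block_graph_pmf_def set_replicate_pmf)

lemma d1_prop_nonneg: "0 \<le> d1_prop G \<H>"
  unfolding d1_prop_def by (intro INF_greatest) (simp add: d1_def)

lemma d1_le_1: "d1 G G' \<le> 1"
proof -
  have "card (mismatches G G') \<le> card ({..<nverts G} \<times> {..<nverts G})"
    by (intro card_mono) (auto simp: mismatches_def)
  hence "real (card (mismatches G G')) \<le> (real (nverts G))\<^sup>2"
    by (simp add: power2_eq_square flip: of_nat_mult)
  thus ?thesis
    by (cases "nverts G = 0") (simp_all add: d1_eq_card_mismatches divide_le_eq_1)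
qed

text \<open>A larger graph would induce one on its first \<open>N\<close> vertices.\<close>

lemma hereditary_empty_above:
  assumes \<H>: "hereditary \<H>" and none: "\<And>G'. G' \<in> \<H> \<Longrightarrow> nverts G' \<noteq> N"
    and n: "n \<ge> N" and G': "G' \<in> \<H>"
  shows "nverts G' \<noteq> n"
proof
  assume "nverts G' = n"
  hence "induced_subgraph G' {..<N} \<in> \<H>"
    using \<H> G' n by (auto simp: hereditary_def)
  with none show False
    by (fastforce simp: induced_subgraph_def)
qed

text \<open>Disposes of the degenerate cases, in which the event contains all sufficiently large graphs:
  the model with a single block and no edges works as well as any other.\<close>

lemma sbm_of_all_graphs:
  assumes "\<forall>\<^sub>F n in sequentially. \<forall>G. nverts G = n \<longrightarrow> P G"
  shows "\<exists>M>0. \<exists>m\<le>M. \<exists>(q :: nat pmf) (p :: nat \<Rightarrow> nat \<Rightarrow> real).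
           sbm_params m q p \<and> (\<forall>i<m. pmf q i = 1 / real m) \<and>
           (\<lambda>n. measure_pmf.prob (consecutive_sbm q p n) {G. P G}) \<longlonglongrightarrow> 1"
proof (intro exI conjI)
  let ?q = "return_pmf (0 :: nat)" and ?p = "\<lambda>_ _ :: nat. 0 :: real"
  have "\<forall>\<^sub>F n in sequentially. measure_pmf.prob (consecutive_sbm ?q ?p n) {G. P G} = 1"
    using assms
  proof eventually_elim
    case (elim n)
    thus ?case
      by (simp add: measure_pmf.prob_eq_1 AE_measure_pmf_iff nverts_consecutive_sbm del: split_paired_All)
  qed
  thus "(\<lambda>n. measure_pmf.prob (consecutive_sbm ?q ?p n) {G. P G}) \<longlonglongrightarrow> 1"
    by (rule tendsto_eventually)
  show "(0::nat) < 1" "(1::nat) \<le> 1" "sbm_params 1 ?q ?p" "\<forall>i<1. pmf ?q i = 1 / real 1"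
    by (auto simp: sbm_params_def)
qed

theorem theorem1p8:
  fixes \<H> :: "ograph set" and \<epsilon> :: real
  assumes "hereditary \<H>" and "\<epsilon> > 0"
  shows "\<exists>M>0. \<exists>m\<le>M. \<exists>(q :: nat pmf) (p :: nat \<Rightarrow> nat \<Rightarrow> real).
           sbm_params m q p \<and> (\<forall>i<m. pmf q i = 1 / real m) \<and>
           (\<lambda>n. measure_pmf.prob (consecutive_sbm q p n)
                  {G. d1_prop G \<H> \<ge> max_d1 \<H> - ereal \<epsilon>}) \<longlonglongrightarrow> 1"
proof -
  consider (trivial) "max_d1 \<H> - ereal \<epsilon> \<le> 0" | (infinite) "max_d1 \<H> = \<infinity>"
    | (finite) r where "max_d1 \<H> = ereal (r + \<epsilon>)" "r > 0"
  proof (cases "max_d1 \<H>")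
    case (real x)
    thus ?thesis
      using that(1) that(3)[of "x - \<epsilon>"] by (cases "x \<le> \<epsilon>") auto
  qed (use that in auto)
  thus ?thesis
  proof cases
    case trivial
    hence "max_d1 \<H> - ereal \<epsilon> \<le> d1_prop G \<H>" for G
      using d1_prop_nonneg order_trans by blast
    thus ?thesis
      by (intro sbm_of_all_graphs) auto
  next
    case infinite
    \<comment> \<open>Finite distances are at most \<open>1\<close>, so a distance above \<open>1\<close> is infinite.\<close>
    hence "1 < max_d1 \<H>"
      by simp
    then obtain G where G: "1 < d1_prop G \<H>"
      unfolding max_d1_def by (auto simp: less_SUP_iff)
    have none: "nverts G' \<noteq> nverts G" if "G' \<in> \<H>" for G'
    proof
      assume "nverts G' = nverts G"
      hence "d1_prop G \<H> \<le> ereal (d1 G G')"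
        unfolding d1_prop_def using that by (intro INF_lower) auto
      also have "\<dots> \<le> 1"
        using d1_le_1 by simp
      finally show False
        using G by simp
    qed
    have "d1_prop G' \<H> = \<infinity>" if "nverts G' \<ge> nverts G" for G'
    proof -
      have "{G'' \<in> \<H>. nverts G'' = nverts G'} = {}"
        using hereditary_empty_above[OF assms(1) none that] by blast
      thus ?thesis
        by (simp only: d1_prop_def image_empty Inf_empty top_ereal_def)
    qed
    thus ?thesis
      by (intro sbm_of_all_graphs) (auto intro: eventually_mono[OF eventually_ge_at_top[of "nverts G"]])
  next
    case finite
    hence "ereal r < max_d1 \<H>"
      using assms(2) by simp
    then obtain G where G: "simple_ograph G" "ereal r < d1_prop G \<H>"
      unfolding max_d1_def by (auto simp: less_SUP_iff)
    then obtain d where d: "r < d" "ereal d \<le> d1_prop G \<H>"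
      using ereal_dense2[OF G(2)] by (auto intro: less_imp_le)
    define N where "N = nverts G"
    \<comment> \<open>The empty graph has distance \<open>0\<close> from \<open>\<H>\<close>, or \<open>\<infinity>\<close> if \<open>\<H>\<close> lacks it; but the distance of \<open>G\<close>
      is above \<open>r > 0\<close> and at most the finite supremum.\<close>
    have N: "N > 0"
    proof (rule ccontr)
      assume "\<not> N > 0"
      hence "d1_prop G \<H> = (INF G'\<in>{G' \<in> \<H>. nverts G' = nverts G}. 0)"
        by (simp add: d1_prop_def d1_def N_def zero_ereal_def)
      moreover have "d1_prop G \<H> \<le> max_d1 \<H>"
        unfolding max_d1_def using G(1) by (intro SUP_upper) auto
      ultimately show False
        using G(2) finite
        by (cases "{G' \<in> \<H>. nverts G' = nverts G} = {}") (auto simp: top_ereal_def)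
    qed
    \<comment> \<open>Blocks with this fraction of their expected size still guarantee the distance \<open>\<theta>\<^sup>2 d = r\<close>.\<close>
    define \<theta> where "\<theta> = sqrt (r / d)"
    have \<theta>: "0 \<le> \<theta>" "\<theta> < 1" "\<theta>\<^sup>2 * d = r"
      using finite(2) d(1) by (auto simp: \<theta>_def)
    let ?q = "pmf_of_set {..<N}" and ?p = "\<lambda>i j. of_bool ((i, j) \<in> adj G) :: real"
    have set_q: "set_pmf ?q = {..<N}"
      using N by (intro set_pmf_of_set) auto
    have good: "max_d1 \<H> - ereal \<epsilon> \<le> d1_prop (blow_up G (sort c)) \<H>"
      if "n > 0" "length c = n" "\<forall>i<N. \<theta> * (real n / real N) \<le> real (count_list c i)" for n c
    proof -
      have "count_list (sort c) i = count_list c i" for i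
        by (metis count_mset mset_sort)
      hence "ereal (\<theta>\<^sup>2 * d) \<le> d1_prop (blow_up G (sort c)) \<H>"
        using that N d finite(2) \<theta>(1) unfolding N_def
        by (intro d1_prop_blow_up_ge[OF assms(1) G(1) d(2)]) (auto simp flip: length_0_conv)
      thus ?thesis
        using finite(1) \<theta>(3) by simp
    qed
    have bound: "measure_pmf.prob (replicate_pmf n ?q)
                   {c. \<forall>i<N. \<theta> * (real n / real N) \<le> real (count_list c i)}
                 \<le> measure_pmf.prob (consecutive_sbm ?q ?p n) {G. d1_prop G \<H> \<ge> max_d1 \<H> - ereal \<epsilon>}"
      if n: "n > 0" for n
    proof -
      have "length c = n" if "c \<in> set_pmf (replicate_pmf n ?q)" for c
        using that by (simp add: set_replicate_pmf)
      thus ?thesis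
        using good[OF n] set_q
        by (subst consecutive_sbm_0_1[OF G(1)])
           (auto simp: N_def AE_measure_pmf_iff intro!: measure_pmf.finite_measure_mono_AE)
    qed
    have "(\<lambda>n. measure_pmf.prob (consecutive_sbm ?q ?p n)
                 {G. d1_prop G \<H> \<ge> max_d1 \<H> - ereal \<epsilon>}) \<longlonglongrightarrow> 1"
      by (rule tendsto_sandwich[OF _ _ blocks_large_tendsto_1[OF N \<theta>(2)] tendsto_const])
         (use bound in \<open>auto intro: eventually_mono[OF eventually_gt_at_top[of 0]]\<close>)
    moreover have "sbm_params N ?q ?p"
      using set_q G(1) by (auto simp: sbm_params_def simple_ograph_def sym_def)
    moreover have "\<forall>i<N. pmf ?q i = 1 / real N"
      using N by (subst pmf_of_set) auto
    ultimately show ?thesis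
      using N by blast
  qed
qed

end
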